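(* Let $D$ be an oriented graph with $\operatorname{inv}(D)=1$, let $z\in V(D)$, and let $H=\sigma_1(x_2,\sigma_2(z, D))$. Then $\operatorname{inv}(H)=3$.
   Context: An oriented graph is a digraph with no loops, no multiple arcs and no directed cycle of length 2. Inverting a vertex set $X$ means reversing every arc with both ends in $X$. $\operatorname{inv}(D)$ is the minimum number of successive inversions needed to make the oriented graph $D$ acyclic. For an oriented graph $D$ and $z\in V(D)$, the $z$-augmentation $\sigma_i(z,D)$ is obtained from $D$ by adding two new vertices $y_i$ and $x_i$, the arcs $zy_i$, $y_ix_i$, $x_iz$, and all arcs from $\{x_i,y_i\}$ to $V(D)\setminus\{z\}$. Thus $\sigma_2(z,D)$ has new vertices $x_2,y_2$, and $H$ is the $x_2$-augmentation of $\sigma_2(z,D)$ with new vertices $x_1,y_1$. *)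

theory Defs
  imports "Graph_Theory.Pair_Digraph" "HOL-Library.Extended_Nat"
begin

text \<open>
  Arcs are ordered pairs of vertices, so there are no multiple arcs. Graphs need not be finite.
\<close>

locale oriented_graph = pair_loopfree_digraph +
  assumes no_digons: "(u, v) \<in> parcs G \<Longrightarrow> (v, u) \<notin> parcs G"

definition invert :: "'a set \<Rightarrow> 'a pair_pre_digraph \<Rightarrow> 'a pair_pre_digraph" where
  "invert X D = D\<lparr>parcs :=
     {(u, v). if u \<in> X \<and> v \<in> X then (v, u) \<in> parcs D else (u, v) \<in> parcs D}\<rparr>"

text \<open>
  The value is \<open>\<infinity>\<close> if no finite sequence of inversions makes the graph acyclic (only
  possible for infinite graphs); otherwise the infimum is an attained minimum.
\<close>

definition inversion_number :: "'a pair_pre_digraph \<Rightarrow> enat" where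
  "inversion_number D =
     (INF Xs \<in> {Xs. (\<forall>X \<in> set Xs. X \<subseteq> pverts D) \<and> acyclic (parcs (fold invert Xs D))}.
        enat (length Xs))"

text \<open>
  The \<open>z\<close>-augmentation of \<open>D\<close>; meaningful for distinct \<open>x\<close>, \<open>y\<close> that are not vertices of \<open>D\<close>.
\<close>

definition augmentation :: "'a \<Rightarrow> 'a \<Rightarrow> 'a \<Rightarrow> 'a pair_pre_digraph \<Rightarrow> 'a pair_pre_digraph" where
  "augmentation x y z D =
     \<lparr>pverts = {x, y} \<union> pverts D,
      parcs = parcs D \<union> {(z, y), (y, x), (x, z)} \<union> {x, y} \<times> (pverts D - {z})\<rparr>"

lemma oriented_graph_invert:
  assumes "oriented_graph D"
  shows "oriented_graph (invert X D)"
proof -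
  interpret oriented_graph D by fact
  show ?thesis
    by unfold_locales
      (auto simp: invert_def split: if_splits
        dest: in_arcsD1 in_arcsD2 pair_no_loops no_digons)
qed

lemma oriented_graph_augmentation:
  assumes "oriented_graph D" "z \<in> pverts D" "x \<noteq> y" "x \<notin> pverts D" "y \<notin> pverts D"
  shows "oriented_graph (augmentation x y z D)"
proof -
  interpret oriented_graph D by fact
  show ?thesis
    using assms(2-)
    by unfold_locales
      (auto simp: augmentation_def dest: in_arcsD1 in_arcsD2 pair_no_loops no_digons)
qed

end

theory Submission
  imports Defs
begin

text \<open>
  Upper bound: once \<open>D\<close> is acyclic, inverting \<open>{z, y}\<close> in its \<open>z\<close>-augmentation turns \<open>y\<close>, then \<open>x\<close>
  into sources, so an augmentation costs at most one further inversion.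

  Lower bound: two inversions assign to every vertex a label in \<open>\<bbbF>\<^sub>2\<^sup>2\<close>, and an arc is reversed iff
  the inner product of the labels of its ends is 1. Suppose that the result is acyclic. When the
  labels of \<open>x1\<close> and \<open>y1\<close> are independent, the position of a vertex of \<open>D\<close> relative to \<open>x1\<close> and \<open>y1\<close>
  determines its label. When they are dependent, inspecting the triangles on the new vertices and
  one vertex of \<open>D\<close> shows that at most one nonzero label occurs in \<open>D\<close>, and that either no arc of \<open>D\<close>
  is reversed or \<open>x1\<close> or \<open>x2\<close> separates the vertices with this label from those with label 0.
  So, unless \<open>D\<close> itself is unchanged, its label classes are consecutive blocks, at most three,
  with label 0 last; undoing the inversions reverses some blocks and possibly swaps the first two,
  hence \<open>D\<close> was acyclic already, contradicting \<open>inv(D) = 1\<close>.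
\<close>

section \<open>Augmentation costs at most one inversion\<close>

text \<open>No arc enters \<open>x\<close>, so a closed walk cannot start there, and a walk starting
  elsewhere never meets \<open>x\<close> and uses only arcs of \<open>r\<close>.\<close>

lemma acyclic_add_source:
  assumes "acyclic r" "x \<notin> Range r" "x \<notin> A"
  shows "acyclic (r \<union> {x} \<times> A)"
proof (rule acyclicI, intro allI notI)
  fix v
  assume v: "(v, v) \<in> (r \<union> {x} \<times> A)\<^sup>+"
  have "v \<noteq> x"
    using tranclD2[OF v] assms(2,3) by auto
  have "(a, b) \<in> r\<^sup>+ \<and> b \<noteq> x" if "(a, b) \<in> (r \<union> {x} \<times> A)\<^sup>+" "a \<noteq> x" for a b
    using that
  proof (induction rule: trancl_induct)
    case (base b)
    then show ?case using assms(2) by auto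
  next
    case (step b c)
    then have "(b, c) \<in> r" "(a, b) \<in> r\<^sup>+" by auto
    then show ?case using assms(2) by (auto intro: trancl_into_trancl)
  qed
  from this[OF v \<open>v \<noteq> x\<close>] show False
    using assms(1) by (simp add: acyclic_def)
qed

lemma pverts_invert [simp]: "pverts (invert X D) = pverts D"
  by (simp add: invert_def)

lemma pverts_augmentation [simp]: "pverts (augmentation x y z D) = {x, y} \<union> pverts D"
  by (simp add: augmentation_def)

lemma pverts_fold_invert [simp]: "pverts (fold invert Xs D) = pverts D"
  by (induction Xs arbitrary: D) auto

lemma oriented_graph_fold_invert:
  "oriented_graph D \<Longrightarrow> oriented_graph (fold invert Xs D)"
  by (induction Xs arbitrary: D) (auto intro: oriented_graph_invert)

lemma invert_empty [simp]: "invert {} D = D"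
  by (simp add: invert_def)

text \<open>Every added arc has an end in \<open>{x, y}\<close>, which is disjoint from
  \<open>X\<close>, so the inversion acts on the arcs of \<open>D\<close> alone.\<close>

lemma invert_augmentation:
  assumes "X \<subseteq> pverts D" "x \<notin> pverts D" "y \<notin> pverts D"
  shows "invert X (augmentation x y z D) = augmentation x y z (invert X D)"
proof -
  have "x \<notin> X" "y \<notin> X" using assms by auto
  then show ?thesis
    by (auto simp: invert_def augmentation_def)
qed

lemma fold_invert_augmentation:
  assumes "\<forall>X\<in>set Xs. X \<subseteq> pverts D" "x \<notin> pverts D" "y \<notin> pverts D"
  shows "fold invert Xs (augmentation x y z D) = augmentation x y z (fold invert Xs D)"
  using assms by (induction Xs arbitrary: D) (auto simp: invert_augmentation)

lemma acyclic_invert_augmentation: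
  assumes "oriented_graph D" "acyclic (parcs D)"
    and "z \<in> pverts D" "x \<noteq> y" "x \<notin> pverts D" "y \<notin> pverts D"
  shows "acyclic (parcs (invert {z, y} (augmentation x y z D)))"
proof -
  interpret oriented_graph D by fact
  have "parcs (invert {z, y} (augmentation x y z D)) =
      parcs D \<union> {x} \<times> pverts D \<union> {y} \<times> ({x} \<union> pverts D)"
    using assms by (auto simp: invert_def augmentation_def dest: in_arcsD1 in_arcsD2 pair_no_loops)
  moreover have "acyclic (parcs D \<union> {x} \<times> pverts D)"
    using assms by (intro acyclic_add_source) (auto dest: in_arcsD2)
  then have "acyclic (parcs D \<union> {x} \<times> pverts D \<union> {y} \<times> ({x} \<union> pverts D))"
    using assms by (intro acyclic_add_source) (auto dest: in_arcsD2)
  ultimately show ?thesis by simp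
qed

lemma inversion_number_le:
  assumes "\<forall>X\<in>set Xs. X \<subseteq> pverts D" "acyclic (parcs (fold invert Xs D))"
  shows "inversion_number D \<le> enat (length Xs)"
  unfolding inversion_number_def using assms by (intro INF_lower) simp

lemma inversion_number_attained:
  assumes "inversion_number D \<noteq> \<infinity>"
  obtains Xs where "\<forall>X\<in>set Xs. X \<subseteq> pverts D" "acyclic (parcs (fold invert Xs D))"
    "inversion_number D = enat (length Xs)"
proof -
  let ?S = "{Xs. (\<forall>X\<in>set Xs. X \<subseteq> pverts D) \<and> acyclic (parcs (fold invert Xs D))}"
  have "?S \<noteq> {}"
  proof
    assume "?S = {}"
    then have "inversion_number D = \<infinity>"
      unfolding inversion_number_def by (simp only: image_empty Inf_enat_def) simp
    then show False using assms by simp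
  qed
  then obtain Ys where "Ys \<in> ?S" by blast
  then have "inversion_number D \<in> (\<lambda>Xs. enat (length Xs)) ` ?S"
    unfolding inversion_number_def by (intro wellorder_InfI[of "enat (length Ys)"] imageI)
  then show thesis using that by auto
qed

lemma inversion_number_augmentation_le:
  assumes D: "oriented_graph D" and z: "z \<in> pverts D"
    and xy: "x \<noteq> y" "x \<notin> pverts D" "y \<notin> pverts D"
  shows "inversion_number (augmentation x y z D) \<le> inversion_number D + 1"
proof (cases "inversion_number D = \<infinity>")
  case False
  then obtain Xs where Xs: "\<forall>X\<in>set Xs. X \<subseteq> pverts D" "acyclic (parcs (fold invert Xs D))"
    "inversion_number D = enat (length Xs)"
    by (rule inversion_number_attained)
  \<comment> \<open>The inversions in \<open>Xs\<close> commute with the augmentation, so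
    \<open>{z, y}\<close> is inverted in an augmentation of an acyclic graph.\<close>
  have "acyclic (parcs (fold invert (Xs @ [{z, y}]) (augmentation x y z D)))"
    using acyclic_invert_augmentation[OF oriented_graph_fold_invert[OF D] Xs(2)] z xy
    by (simp add: fold_invert_augmentation[OF Xs(1) xy(2,3)])
  then have "inversion_number (augmentation x y z D) \<le> enat (length (Xs @ [{z, y}]))"
    using Xs(1) z by (intro inversion_number_le) auto
  then show ?thesis
    by (simp add: Xs(3) one_enat_def)
qed simp

section \<open>Two inversions do not suffice\<close>

text \<open>
  The label of \<open>v\<close> is \<open>(p v, q v)\<close>, the \<open>i\<close>-th entry recording whether \<open>v\<close> lies in the \<open>i\<close>-th inverted
  set, and \<open>lt\<close> is reachability after the two inversions; hence every arc \<open>uv\<close> present before them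
  satisfies \<open>pre_arc u v\<close>.
\<close>

locale labelled_order =
  fixes p q :: "'a \<Rightarrow> bool" and lt :: "'a \<Rightarrow> 'a \<Rightarrow> bool"
  assumes lt_trans: "lt u v \<Longrightarrow> lt v w \<Longrightarrow> lt u w"
    and lt_irrefl: "\<not> lt u u"
begin

section \<open>Triangles and label blocks in a labelled order\<close>

definition dot :: "'a \<Rightarrow> 'a \<Rightarrow> bool" where
  "dot u v \<longleftrightarrow> (p u \<and> p v) \<noteq> (q u \<and> q v)"

definition pre_arc :: "'a \<Rightarrow> 'a \<Rightarrow> bool" where
  "pre_arc u v \<longleftrightarrow> (if dot u v then lt v u else lt u v)"

lemma lt_asym: "lt u v \<Longrightarrow> \<not> lt v u"
  using lt_trans lt_irrefl by blast

lemma dot_commute: "dot u v = dot v u"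
  by (auto simp: dot_def)

lemma pre_arc_irrefl: "\<not> pre_arc u u"
  using lt_irrefl by (simp add: pre_arc_def)

text \<open>If all or none of the arcs of a directed triangle are reversed, a directed triangle
  remains, contradicting that \<open>lt\<close> is a strict order.\<close>

lemma dot_cyclic_triangle:
  "pre_arc u v \<Longrightarrow> pre_arc v w \<Longrightarrow> pre_arc w u \<Longrightarrow> \<not> (dot u v = dot v w \<and> dot v w = dot w u)"
  using lt_trans lt_irrefl unfolding pre_arc_def by (smt (verit))

text \<open>Reversing only the shortcut \<open>uw\<close>, or only the two arcs of the path, turns a
  transitive triangle into a cyclic one.\<close>

lemma dot_transitive_triangle:
  "pre_arc u v \<Longrightarrow> pre_arc v w \<Longrightarrow> pre_arc u w \<Longrightarrow> dot u v = dot v w \<Longrightarrow> dot u w = dot u v"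
  using lt_trans lt_irrefl unfolding pre_arc_def by (smt (verit))

text \<open>The rank classes are consecutive blocks of \<open>lt\<close> with constant labels. Hence
  each block is reversed or kept as a whole, the direction between two blocks is uniform, and only
  blocks 0 and 1 can swap.\<close>

lemma pre_arc_trans_if_ranked:
  fixes r :: "'a \<Rightarrow> nat"
  assumes lt: "\<And>a b. a \<in> V \<Longrightarrow> b \<in> V \<Longrightarrow> r a < r b \<Longrightarrow> lt a b"
    and eq: "\<And>a b. a \<in> V \<Longrightarrow> b \<in> V \<Longrightarrow> r a = r b \<Longrightarrow> p a = p b \<and> q a = q b"
    and two: "\<And>a. a \<in> V \<Longrightarrow> r a = 2 \<Longrightarrow> \<not> p a \<and> \<not> q a" "\<And>a. r a \<le> 2"
    and V: "u \<in> V" "v \<in> V" "w \<in> V" and arcs: "pre_arc u v" "pre_arc v w"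
  shows "pre_arc u w"
proof -
  have cong: "dot a c = dot b c" "dot c a = dot c b" if "a \<in> V" "b \<in> V" "r a = r b" for a b c
    using eq[OF that] by (auto simp: dot_def)
  have zero: "\<not> dot a b" "\<not> dot b a" if "b \<in> V" "r b = 2" for a b
    using two(1)[OF that] by (auto simp: dot_def)
  have range: "r a = 0 \<or> r a = 1 \<or> r a = 2" for a
    using two(2)[of a] by linarith
  have pre_arc_iff: "pre_arc a b \<longleftrightarrow> (dot a b \<longleftrightarrow> r b < r a)"
    if "a \<in> V" "b \<in> V" "r a \<noteq> r b" for a b
    using lt[of a b] lt[of b a] lt_asym that unfolding pre_arc_def by (cases "r a < r b") auto
  consider "r u = r v" "r v = r w" | "r u = r v" "r v \<noteq> r w" | "r u \<noteq> r v" "r v = r w"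
    | "r u \<noteq> r v" "r u = r w" | "r u \<noteq> r v" "r u \<noteq> r w" "r v \<noteq> r w"
    by metis
  then show ?thesis
  proof cases
    case 1
    then show ?thesis using arcs lt_trans cong V unfolding pre_arc_def by metis
  next
    case 2
    then show ?thesis
      using arcs pre_arc_iff[OF V(2,3)] pre_arc_iff[OF V(1,3)] cong(1)[OF V(1,2)] by simp
  next
    case 3
    then show ?thesis
      using arcs pre_arc_iff[OF V(1,2)] pre_arc_iff[OF V(1,3)] cong(2)[OF V(2,3)] by simp
  next
    \<comment> \<open>Impossible: all arcs between two given blocks point the same way, so no path
      leaves a block and returns.\<close>
    case 4
    then show ?thesis
      using arcs pre_arc_iff[OF V(1,2)] pre_arc_iff[OF V(2,3)] cong(2)[OF V(1,3), of v]
        dot_commute[of u v]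
      by auto
  next
    \<comment> \<open>All three ranks occur, and the vertex of rank 2 is orthogonal to the others,
      so it comes last both in \<open>lt\<close> and in \<open>pre_arc\<close>.\<close>
    case 5
    then show ?thesis
      using arcs pre_arc_iff[OF V(1,2)] pre_arc_iff[OF V(2,3)] pre_arc_iff[OF V(1,3)]
        range[of u] range[of v] range[of w] zero[OF V(1)] zero[OF V(2)] zero[OF V(3)]
      by (elim disjE) simp_all
  qed
qed

lemma pre_arc_trans_if_independent:
  assumes indep: "p x \<or> q x" "p y \<or> q y" "p x \<noteq> p y \<or> q x \<noteq> q y"
    and arcs: "\<And>w. w \<in> V \<Longrightarrow> pre_arc x w" "\<And>w. w \<in> V \<Longrightarrow> pre_arc y w" "pre_arc y x"
    and V: "u \<in> V" "v \<in> V" "w \<in> V" and uvw: "pre_arc u v" "pre_arc v w"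
  shows "pre_arc u w"
\<comment> \<open>For \<open>w\<close> in \<open>V\<close>, \<open>\<not> dot x w\<close> means
  \<open>lt x w\<close>, so the rank counts how many of \<open>x\<close> and \<open>y\<close>
  precede \<open>w\<close>.\<close>
proof (rule pre_arc_trans_if_ranked[where r = "\<lambda>w. of_bool (\<not> dot x w) + of_bool (\<not> dot y w)"])
  \<comment> \<open>This encodes the order of \<open>x\<close> and \<open>y\<close> in
    \<open>lt\<close>: it rules out one of the two ways to have rank 1, so the rank determines both
    products.\<close>
  have between: "dot y x = dot x a \<longrightarrow> dot y a = dot y x" if "a \<in> V" for a
    using dot_transitive_triangle[OF arcs(3) arcs(1)[OF that] arcs(2)[OF that]] by blast
  fix a b
  assume ab: "a \<in> V" "b \<in> V"
  {
    assume "of_bool (\<not> dot x a) + of_bool (\<not> dot y a) <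
      (of_bool (\<not> dot x b) + of_bool (\<not> dot y b) :: nat)"
    \<comment> \<open>So \<open>x\<close> or \<open>y\<close> lies between \<open>a\<close> and
      \<open>b\<close> in \<open>lt\<close>.\<close>
    then have "dot x a \<and> \<not> dot x b \<or> dot y a \<and> \<not> dot y b"
      by (auto simp: of_bool_def split: if_splits)
    then show "lt a b"
      using arcs(1,2)[OF ab(1)] arcs(1,2)[OF ab(2)] lt_trans unfolding pre_arc_def by metis
  next
    assume "of_bool (\<not> dot x a) + of_bool (\<not> dot y a) =
      (of_bool (\<not> dot x b) + of_bool (\<not> dot y b) :: nat)"
    then have "dot x a = dot x b \<and> dot y a = dot y b"
      using between[OF ab(1)] between[OF ab(2)] by (auto simp: of_bool_def split: if_splits)
    \<comment> \<open>Products with two independent vectors of a plane determine the label.\<close>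
    then show "p a = p b \<and> q a = q b"
      using indep unfolding dot_def by blast
  next
    assume "of_bool (\<not> dot x a) + of_bool (\<not> dot y a) = (2::nat)"
    then have "\<not> dot x a \<and> \<not> dot y a"
      by (auto simp: of_bool_def split: if_splits)
    then show "\<not> p a \<and> \<not> q a"
      using indep unfolding dot_def by blast
  }
qed (use V uvw in \<open>auto simp: of_bool_def\<close>)

end

section \<open>Constraints on labels in the double augmentation\<close>

locale labelled_double_augmentation = labelled_order p q lt
  for p q :: "'a \<Rightarrow> bool" and lt +
  fixes D :: "'a pair_pre_digraph" and z x1 y1 x2 y2 :: 'a
  assumes z_in: "z \<in> pverts D"
    and x2_notin: "x2 \<notin> pverts D"
    and x2_neq_y2: "x2 \<noteq> y2"
    and arcs: "(u, v) \<in> parcs (augmentation x1 y1 x2 (augmentation x2 y2 z D)) \<Longrightarrow> pre_arc u v"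
begin

lemma new_arcs:
  "pre_arc y1 x1" "pre_arc x1 x2" "pre_arc x2 y1" "pre_arc x1 y2"
  "pre_arc y1 y2" "pre_arc y2 x2" "pre_arc x2 z" "pre_arc z y2"
  using x2_neq_y2 by (auto intro!: arcs simp: augmentation_def)

lemma arcs_into_D:
  assumes "w \<in> pverts D"
  shows "pre_arc x1 w" "pre_arc y1 w" "pre_arc x2 w"
proof -
  show "pre_arc x1 w" "pre_arc y1 w"
    using assms x2_notin by (auto intro!: arcs simp: augmentation_def)
  show "pre_arc x2 w"
    using assms new_arcs(7) by (cases "w = z") (auto intro!: arcs simp: augmentation_def)
qed

lemma pre_arc_y2_into_D: "w \<in> pverts D \<Longrightarrow> w \<noteq> z \<Longrightarrow> pre_arc y2 w"
  by (auto intro!: arcs simp: augmentation_def)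

lemma dependent_labels:
  assumes dep: "\<not> (p x1 \<or> q x1) \<or> \<not> (p y1 \<or> q y1) \<or> (p x1 = p y1 \<and> q x1 = q y1)"
  shows "(\<forall>u\<in>pverts D. \<forall>v\<in>pverts D. u \<noteq> v \<longrightarrow> \<not> dot u v) \<or>
    (\<forall>u\<in>pverts D. \<forall>v\<in>pverts D. (p u \<or> q u) \<and> (p u \<noteq> p v \<or> q u \<noteq> q v) \<longrightarrow>
      \<not> (p v \<or> q v) \<and> lt u v)" (is "?unreversed \<or> ?separated")
proof -
  have triangles: "\<not> (dot y1 x1 = dot x1 x2 \<and> dot x1 x2 = dot x2 y1)"
    "\<not> (dot z y2 = dot y2 x2 \<and> dot y2 x2 = dot x2 z)"
    "dot y1 x1 = dot x1 y2 \<longrightarrow> dot y1 y2 = dot y1 x1"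
    "\<not> (dot x2 y1 = dot y1 y2 \<and> dot y1 y2 = dot y2 x2)"
    "dot x1 y2 = dot y2 x2 \<longrightarrow> dot x1 x2 = dot y2 x2"
    using dot_cyclic_triangle dot_transitive_triangle new_arcs by blast+
  have triangles_w: "dot y1 x1 = dot x1 w \<longrightarrow> dot y1 w = dot y1 x1"
    "dot x2 y1 = dot y1 w \<longrightarrow> dot x2 w = dot x2 y1"
    "dot x1 x2 = dot x2 w \<longrightarrow> dot x1 w = dot x1 x2"
    if "w \<in> pverts D" for w
    using dot_transitive_triangle new_arcs arcs_into_D[OF that] by blast+
  have triangles_z: "dot x1 z = dot z y2 \<longrightarrow> dot x1 y2 = dot x1 z"
    "dot y1 z = dot z y2 \<longrightarrow> dot y1 y2 = dot y1 z"
    using dot_transitive_triangle new_arcs arcs_into_D[OF z_in] by blast+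
  have triangles_nz: "dot y2 x2 = dot x2 w \<longrightarrow> dot y2 w = dot y2 x2"
    "dot x1 y2 = dot y2 w \<longrightarrow> dot x1 w = dot x1 y2"
    "dot y1 y2 = dot y2 w \<longrightarrow> dot y1 w = dot y1 y2"
    if "w \<in> pverts D" "w \<noteq> z" for w
    using dot_transitive_triangle new_arcs arcs_into_D[OF that(1)] pre_arc_y2_into_D[OF that] by blast+
  note base = dep triangles triangles_w[OF z_in] triangles_z

  \<comment> \<open>What remains is a propositional problem about the labels of finitely many
    vertices. The vertex \<open>z\<close> is treated apart because its arc with \<open>y2\<close>
    has the opposite direction.\<close>
  have one_label_nz: "(\<not> p a \<and> \<not> q a) \<or> p a = p b \<and> q a = q b \<or> (\<not> p b \<and> \<not> q b)"
    if "a \<in> pverts D" "a \<noteq> z" "b \<in> pverts D" "b \<noteq> z" for a b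
    using base triangles_nz[OF that(1,2)] triangles_nz[OF that(3,4)]
      triangles_w[OF that(1)] triangles_w[OF that(3)]
    unfolding dot_def by (smt (verit))
  have one_label_z: "(\<not> p a \<and> \<not> q a) \<or> p a = p z \<and> q a = q z \<or> (\<not> p z \<and> \<not> q z)"
    if "a \<in> pverts D" "a \<noteq> z" for a
    using base triangles_nz[OF that] triangles_w[OF that(1)] unfolding dot_def by (smt (verit))
  have one_label: "(\<not> p a \<and> \<not> q a) \<or> p a = p b \<and> q a = q b \<or> (\<not> p b \<and> \<not> q b)"
    if "a \<in> pverts D" "b \<in> pverts D" for a b
    using one_label_nz[of a b] one_label_z[of a] one_label_z[of b] that by blast
  \<comment> \<open>Since \<open>x1\<close> and \<open>x2\<close> dominate \<open>D\<close>, the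
    conclusion puts one of them after \<open>a\<close> and before \<open>b\<close> in
    \<open>lt\<close>.\<close>
  have separator: "(dot x1 a \<and> \<not> dot x1 b) \<or> (dot x2 a \<and> \<not> dot x2 b)"
    if "u \<in> pverts D" "u \<noteq> z" "dot u u" "p a = p u" "q a = q u" "\<not> p b" "\<not> q b"
      "a \<in> pverts D" "b \<in> pverts D" for u a b
  proof -
    note facts = that base triangles_nz[OF that(1,2)] triangles_w[OF that(1)]
      triangles_w[OF that(8)] triangles_w[OF that(9)]
    consider "a = z" | "b = z" | "a \<noteq> z" "b \<noteq> z" by blast
    then show ?thesis
    proof cases
      case 1
      then show ?thesis using facts triangles_nz[of b] unfolding dot_def by (smt (verit))
    next
      case 2
      then show ?thesis using facts triangles_nz[of a] unfolding dot_def by (smt (verit))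
    next
      case 3
      then show ?thesis using facts triangles_nz[of a] triangles_nz[of b]
        unfolding dot_def by (smt (verit))
    qed
  qed
  show ?thesis
  proof (cases ?unreversed)
    case False
    then obtain u v where uv: "u \<in> pverts D" "v \<in> pverts D" "u \<noteq> v" "dot u v" by blast
    \<comment> \<open>Both \<open>u\<close> and \<open>v\<close> have nonzero labels, which
      therefore coincide; \<open>g\<close> is one of them other than \<open>z\<close>, and
      \<open>dot g g\<close> inherits its value from \<open>dot u v\<close>.\<close>
    define g where "g = (if u = z then v else u)"
    have g: "g \<in> pverts D" "g \<noteq> z" "dot g g" "p g \<or> q g"
      using uv one_label[OF uv(1,2)] unfolding g_def dot_def by (auto split: if_splits)
    have "\<not> (p b \<or> q b) \<and> lt a b"
      if "a \<in> pverts D" "b \<in> pverts D" "p a \<or> q a" "p a \<noteq> p b \<or> q a \<noteq> q b" for a b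
    proof -
      have b: "\<not> p b" "\<not> q b" using one_label[OF that(1,2)] that by auto
      have "p a = p g" "q a = q g" using one_label[OF that(1) g(1)] that g by auto
      from separator[OF g(1-3) this b that(1,2)] have "lt a b"
        using arcs_into_D[OF that(1)] arcs_into_D[OF that(2)]
          lt_trans[of a x1 b] lt_trans[of a x2 b]
        unfolding pre_arc_def by metis
      with b show ?thesis by simp
    qed
    then show ?thesis by blast
  qed simp
qed

lemma pre_arc_trans:
  assumes V: "u \<in> pverts D" "v \<in> pverts D" "w \<in> pverts D" and uvw: "pre_arc u v" "pre_arc v w"
  shows "pre_arc u w"
proof (cases "(p x1 \<or> q x1) \<and> (p y1 \<or> q y1) \<and> (p x1 \<noteq> p y1 \<or> q x1 \<noteq> q y1)")
  case True
  then show ?thesis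
    using pre_arc_trans_if_independent[of x1 y1 "pverts D"] arcs_into_D new_arcs(1) V uvw by blast
next
  case False
  then consider
      "\<forall>u\<in>pverts D. \<forall>v\<in>pverts D. u \<noteq> v \<longrightarrow> \<not> dot u v"
    | "\<forall>u\<in>pverts D. \<forall>v\<in>pverts D. (p u \<or> q u) \<and> (p u \<noteq> p v \<or> q u \<noteq> q v) \<longrightarrow>
        \<not> (p v \<or> q v) \<and> lt u v"
    using dependent_labels by blast
  then show ?thesis
  proof cases
    case 1
    then have "lt u v" "lt v w"
      using V uvw pre_arc_irrefl unfolding pre_arc_def by metis+
    then show ?thesis
      using 1 V lt_trans lt_asym unfolding pre_arc_def by metis
  next
    case 2
    show ?thesis
    \<comment> \<open>Label 0 gets rank 2, the rank reserved for it; rank 1 stays empty.\<close>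
    proof (rule pre_arc_trans_if_ranked[where r = "\<lambda>w. if p w \<or> q w then 0 else 2"])
      fix a b
      assume ab: "a \<in> pverts D" "b \<in> pverts D"
      {
        assume "(if p a \<or> q a then 0 else 2) < (if p b \<or> q b then 0 else (2::nat))"
        then have "p a \<or> q a" "\<not> (p b \<or> q b)"
          by (auto split: if_splits)
        then show "lt a b" using 2 ab by metis
      next
        assume "(if p a \<or> q a then 0 else 2) = (if p b \<or> q b then 0 else (2::nat))"
        then have "(p a \<or> q a) = (p b \<or> q b)"
          by (auto split: if_splits)
        then show "p a = p b \<and> q a = q b" using 2 ab by metis
      }
    qed (use V uvw in \<open>auto split: if_splits\<close>)
  qed
qed

text \<open>On the vertices of \<open>D\<close>, \<open>pre_arc\<close> is transitive and
  irreflexive and contains all arcs, so it contains every walk but no closed one.\<close>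

lemma acyclic_D:
  assumes "oriented_graph D"
  shows "acyclic (parcs D)"
proof (rule acyclicI, intro allI notI)
  interpret oriented_graph D by fact
  have pre_arc_D: "pre_arc u v" if "(u, v) \<in> parcs D" for u v
    using that by (intro arcs) (auto simp: augmentation_def)
  fix v
  assume "(v, v) \<in> (parcs D)\<^sup>+"
  moreover have "a \<in> pverts D \<and> b \<in> pverts D \<and> pre_arc a b" if "(a, b) \<in> (parcs D)\<^sup>+" for a b
    using that
  proof (induction rule: trancl_induct)
    case (base b)
    then show ?case using pre_arc_D by (auto dest: in_arcsD1 in_arcsD2)
  next
    case (step b c)
    then show ?case using pre_arc_D pre_arc_trans[of a b c] by (auto dest: in_arcsD2)
  qed
  ultimately show False
    using pre_arc_irrefl by blast
qed

end

section \<open>From two inversions to the exact inversion number\<close>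

lemma two_inversions_acyclic_imp_acyclic:
  assumes D: "oriented_graph D" and z: "z \<in> pverts D"
    and new: "distinct [x1, y1, x2, y2]" "{x1, y1, x2, y2} \<inter> pverts D = {}"
    and H: "H = augmentation x1 y1 x2 (augmentation x2 y2 z D)"
    and acyclic: "acyclic (parcs (invert Y (invert X H)))"
  shows "acyclic (parcs D)"
proof -
  \<comment> \<open>An arc is reversed in total iff exactly one of \<open>X\<close> and
    \<open>Y\<close> contains both its ends, which is \<open>dot\<close> for the membership
    labels.\<close>
  let ?lt = "\<lambda>u v. (u, v) \<in> (parcs (invert Y (invert X H)))\<^sup>+"
  interpret L: labelled_order "\<lambda>v. v \<in> X" "\<lambda>v. v \<in> Y" ?lt
    using acyclic by unfold_locales (auto simp: acyclic_def)
  have "L.pre_arc u v" if "(u, v) \<in> parcs H" for u v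
    unfolding L.pre_arc_def L.dot_def
    using that by (auto simp: invert_def intro!: r_into_trancl)
  then interpret labelled_double_augmentation "\<lambda>v. v \<in> X" "\<lambda>v. v \<in> Y" ?lt D z x1 y1 x2 y2
    using z new H by unfold_locales auto
  show ?thesis using acyclic_D D .
qed

theorem theorem4p2:
  fixes D H :: "'a pair_pre_digraph" and z x1 y1 x2 y2 :: 'a
  assumes "oriented_graph D"
    and "inversion_number D = 1"
    and "z \<in> pverts D"
    and "distinct [x1, y1, x2, y2]"
    and "{x1, y1, x2, y2} \<inter> pverts D = {}"
    and "H = augmentation x1 y1 x2 (augmentation x2 y2 z D)"
  shows "inversion_number H = 3"
proof (rule antisym)
  let ?D2 = "augmentation x2 y2 z D"
  have "inversion_number ?D2 \<le> inversion_number D + 1"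
    using assms by (intro inversion_number_augmentation_le) auto
  moreover have "inversion_number H \<le> inversion_number ?D2 + 1"
    unfolding assms(6) using assms
    by (intro inversion_number_augmentation_le oriented_graph_augmentation) auto
  ultimately have "inversion_number H \<le> inversion_number D + 1 + 1"
    by (meson add_right_mono order_trans)
  then show upper: "inversion_number H \<le> 3"
    by (simp add: assms(2) one_enat_def numeral_eq_enat numeral_3_eq_3)
  have cyclic: "\<not> acyclic (parcs D)"
    using inversion_number_le[of "[]" D] assms(2) by (auto simp: zero_enat_def[symmetric])
  have "inversion_number H \<noteq> \<infinity>"
    using upper by (cases "inversion_number H") (auto simp: numeral_eq_enat)
  then obtain Xs where Xs: "acyclic (parcs (fold invert Xs H))"
    "inversion_number H = enat (length Xs)"
    by (rule inversion_number_attained)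
  have "\<not> length Xs < 3"
  proof
    assume "length Xs < 3"
    then consider "Xs = []" | X where "Xs = [X]" | X Y where "Xs = [X, Y]"
      by (auto simp: numeral_3_eq_3 less_Suc_eq length_Suc_conv)
    \<comment> \<open>Shorter sequences are padded with inversions of the empty set.\<close>
    then obtain X Y where "fold invert Xs H = invert Y (invert X H)"
    proof cases
      case 1
      then show ?thesis using that[of "{}" "{}"] by simp
    next
      case (2 X)
      then show ?thesis using that[of "{}" X] by simp
    next
      case (3 X Y)
      then show ?thesis using that[of Y X] by simp
    qed
    then show False
      using two_inversions_acyclic_imp_acyclic[OF assms(1,3-6)] Xs(1) cyclic by simp
  qed
  then show "3 \<le> inversion_number H"
    by (simp add: Xs(2) numeral_eq_enat)
qed

end
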